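(* For every $\ell\ge 1$ the multivariate orthogonal polynomials are Schur complements (equivalently, last quasi-determinants) of bordered truncated moment matrices: $$P_{[\ell]}(x)=\operatorname{SC}\left(\begin{array}{ccc|c} G_{[0],[0]}&\cdots&G_{[0],[\ell-1]}&\chi_{[0]}(x)\\ \vdots&&\vdots&\vdots\\ G_{[\ell-1],[0]}&\cdots&G_{[\ell-1],[\ell-1]}&\chi_{[\ell-1]}(x)\\ \hline G_{[\ell],[0]}&\cdots&G_{[\ell],[\ell-1]}&\chi_{[\ell]}(x)\end{array}\right)=\Theta_*\begin{pmatrix} G_{[0],[0]}&\cdots&G_{[0],[\ell-1]}&\chi_{[0]}(x)\\ \vdots&&\vdots&\vdots\\ G_{[\ell],[0]}&\cdots&G_{[\ell],[\ell-1]}&\chi_{[\ell]}(x)\end{pmatrix}.$$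
   Context: Let $D\ge 1$ and let $\mu$ be a Borel measure on $\Omega\subseteq\mathbb R^D$ with finite moments. For $k\in\mathbb Z_+$ let $[k]=\{\alpha\in\mathbb Z_+^D:|\alpha|=k\}$, ordered as $\alpha_1^{(k)}<\alpha_2^{(k)}<\cdots$, where for $\alpha,\alpha'\in[k]$ one has $\alpha>\alpha'$ iff at the first coordinate where they differ the entry of $\alpha$ is smaller; $|[k]|$ is its cardinality. $\chi_{[k]}(x)$ is the column vector of monomials $x^\alpha$, $\alpha\in[k]$, in this order, and $\chi$ is the semi-infinite column obtained by stacking $\chi_{[0]},\chi_{[1]},\dots$. Semi-infinite matrices are partitioned in blocks $A_{[k],[\ell]}\in\mathbb R^{|[k]|\times|[\ell]|}$; $A^{[\ell]}$ denotes the truncation to the first $\ell$ block rows and columns (block indices $0,\dots,\ell-1$). The moment matrix is $G=\int_\Omega\chi(x)\,d\mu(x)\,\chi(x)^\top$. Standing assumption: $\det G^{[\ell]}\neq0$ for all $\ell$, so that there is a block Cholesky factorization $G=S^{-1}H(S^{-1})^\top$ with $S$ block lower triangular with identity diagonal blocks and $H=\operatorname{diag}(H_{[0]},H_{[1]},\dots)$ block diagonal. The multivariate orthogonal polynomials are $P=S\chi$, with blocks $P_{[k]}(x)=\sum_{\ell=0}^kS_{[k],[\ell]}\chi_{[\ell]}(x)$. For a block matrix with $A$ square invertible, $\operatorname{SC}\left(\begin{array}{c|c}A&B\\ \hline C&E\end{array}\right)=E-CA^{-1}B$. The last quasi-determinant $\Theta_*$ of a partitioned matrix is this Schur complement, where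 $E$ is the lower right corner block and $A$ consists of all block rows and columns except the last ones. *)

theory Defs
  imports
    "HOL-Analysis.Analysis"
    "Jordan_Normal_Form.Gauss_Jordan_Elimination"
    "Jordan_Normal_Form.Determinant"
begin

no_notation Matrix.vec_index (infixl "$" 100)

text \<open>
  \<open>\<real>\<^sup>D\<close> is \<^typ>\<open>real ^ 'd\<close> with a finite, linearly ordered index type; the order on
  \<open>'d\<close> says which coordinate comes first. Multi-indices are \<^typ>\<open>nat ^ 'd\<close>.
\<close>

section \<open>Multi-indices and monomials\<close>

definition multi_indices :: "nat \<Rightarrow> (nat ^ 'd::finite) set" where
  "multi_indices k = {\<alpha>. (\<Sum>i\<in>UNIV. \<alpha> $ i) = k}"

definition block_size :: "'d::finite itself \<Rightarrow> nat \<Rightarrow> nat" where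
  "block_size _ k = card (multi_indices k :: (nat ^ 'd) set)"

definition mi_less :: "nat ^ 'd::{finite,linorder} \<Rightarrow> nat ^ 'd::{finite,linorder} \<Rightarrow> bool" where
  "mi_less \<alpha> \<beta> \<longleftrightarrow> (\<exists>i. (\<forall>j<i. \<alpha> $ j = \<beta> $ j) \<and> \<beta> $ i < \<alpha> $ i)"

definition multi_index_list :: "nat \<Rightarrow> (nat ^ 'd::{finite,linorder}) list" where
  "multi_index_list k = (THE as. sorted_wrt mi_less as \<and> set as = multi_indices k)"

lemma finite_multi_indices: "finite (multi_indices k :: (nat ^ 'd::finite) set)"
proof -
  have "multi_indices k \<subseteq> vec_lambda ` (UNIV \<rightarrow>\<^sub>E {..k} :: ('d \<Rightarrow> nat) set)"
  proof
    fix \<alpha> :: "nat ^ 'd" assume "\<alpha> \<in> multi_indices k"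
    then have "\<alpha> $ i \<le> k" for i
      using member_le_sum[of i UNIV "vec_nth \<alpha>"] by (simp add: multi_indices_def)
    then have "vec_nth \<alpha> \<in> UNIV \<rightarrow>\<^sub>E {..k}" by auto
    then show "\<alpha> \<in> vec_lambda ` (UNIV \<rightarrow>\<^sub>E {..k})" by (metis image_eqI vec_nth_inverse)
  qed
  then show ?thesis by (rule finite_subset) (intro finite_imageI finite_PiE; simp)
qed

lemma mi_less_irrefl: "\<not> mi_less \<alpha> \<alpha>"
  by (simp add: mi_less_def)

lemma mi_less_trans: "mi_less \<alpha> \<beta> \<Longrightarrow> mi_less \<beta> \<gamma> \<Longrightarrow> mi_less \<alpha> \<gamma>"
proof -
  assume "mi_less \<alpha> \<beta>" "mi_less \<beta> \<gamma>"
  then obtain i j where i: "\<forall>m<i. \<alpha> $ m = \<beta> $ m" "\<beta> $ i < \<alpha> $ i"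
    and j: "\<forall>m<j. \<beta> $ m = \<gamma> $ m" "\<gamma> $ j < \<beta> $ j" unfolding mi_less_def by blast
  have "(\<forall>m<min i j. \<alpha> $ m = \<gamma> $ m) \<and> \<gamma> $ min i j < \<alpha> $ min i j"
    using i j by (cases i j rule: linorder_cases) (auto simp: min_def)
  then show ?thesis unfolding mi_less_def by blast
qed

lemma mi_less_total: "\<alpha> \<noteq> \<beta> \<Longrightarrow> mi_less \<alpha> \<beta> \<or> mi_less \<beta> \<alpha>"
proof -
  assume "\<alpha> \<noteq> \<beta>"
  then have ne: "{i. \<alpha> $ i \<noteq> \<beta> $ i} \<noteq> {}" by (auto simp: Finite_Cartesian_Product.vec_eq_iff)
  define i where "i = Min {i. \<alpha> $ i \<noteq> \<beta> $ i}"
  have "\<alpha> $ i \<noteq> \<beta> $ i" using Min_in[OF _ ne] by (simp add: i_def)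
  moreover have "\<alpha> $ j = \<beta> $ j" if "j < i" for j
    using that Min_le[of "{i. \<alpha> $ i \<noteq> \<beta> $ i}" j] unfolding i_def by fastforce
  ultimately show ?thesis unfolding mi_less_def by (metis linorder_neqE_nat)
qed

lemma multi_index_list:
  "sorted_wrt mi_less (multi_index_list k :: (nat ^ 'd::{finite,linorder}) list)"
  "set (multi_index_list k :: (nat ^ 'd::{finite,linorder}) list) = multi_indices k"
proof -
  let ?R = "\<lambda>\<alpha> \<beta> :: nat ^ 'd::{finite,linorder}. mi_less \<alpha> \<beta> \<or> \<alpha> = \<beta>"
  interpret L: linorder ?R mi_less
    by unfold_locales (use mi_less_trans mi_less_irrefl mi_less_total in blast)+
  have "\<exists>!as :: (nat ^ 'd::{finite,linorder}) list. sorted_wrt mi_less as \<and> set as = multi_indices k"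
  proof (rule ex1I)
    let ?as = "L.sorted_list_of_set (multi_indices k)"
    show "sorted_wrt mi_less ?as \<and> set ?as = multi_indices k"
      using L.strict_sorted_list_of_set
        L.sorted_list_of_set.set_sorted_key_list_of_set[OF finite_multi_indices] by simp
    show "as = ?as" if "sorted_wrt mi_less as \<and> set as = multi_indices k"
      for as :: "(nat ^ 'd::{finite,linorder}) list"
      using that L.sorted_list_of_set.idem_if_sorted_distinct[of as] L.strict_sorted_iff[of as]
      by auto
  qed
  then show "sorted_wrt mi_less (multi_index_list k :: (nat ^ 'd::{finite,linorder}) list)"
    and "set (multi_index_list k :: (nat ^ 'd::{finite,linorder}) list) = multi_indices k"
    unfolding multi_index_list_def by (metis (mono_tags, lifting) theI')+
qed

definition monomial :: "nat ^ 'd::finite \<Rightarrow> real ^ 'd \<Rightarrow> real" where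
  "monomial \<alpha> x = (\<Prod>i\<in>UNIV. (x $ i) ^ (\<alpha> $ i))"

definition chi :: "nat \<Rightarrow> real ^ 'd::{finite,linorder} \<Rightarrow> real mat" where
  "chi k x = mat (block_size TYPE('d) k) 1 (\<lambda>(i, _). monomial (multi_index_list k ! i) x)"

section \<open>Block matrices\<close>

text \<open>
  A block matrix is given by its blocks, \<open>A k l\<close> being the block in block row \<open>k\<close> and block
  column \<open>l\<close>. It is semi-infinite, unless an operation only reads finitely many blocks.
\<close>

type_synonym block_matrix = "nat \<Rightarrow> nat \<Rightarrow> real mat"

primrec block_row :: "block_matrix \<Rightarrow> nat \<Rightarrow> nat \<Rightarrow> real mat" where
  "block_row A k 0 = 0\<^sub>m (dim_row (A k 0)) 0"
| "block_row A k (Suc n) =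
     four_block_mat (block_row A k n) (A k n)
       (0\<^sub>m 0 (dim_col (block_row A k n))) (0\<^sub>m 0 (dim_col (A k n)))"

text \<open>The ordinary matrix formed by the first \<open>m\<close> block rows and \<open>n\<close> block columns.\<close>

primrec assemble :: "block_matrix \<Rightarrow> nat \<Rightarrow> nat \<Rightarrow> real mat" where
  "assemble A 0 n = 0\<^sub>m 0 (dim_col (block_row A 0 n))"
| "assemble A (Suc m) n = assemble A m n @\<^sub>r block_row A m n"

abbreviation truncation :: "block_matrix \<Rightarrow> nat \<Rightarrow> real mat" where
  "truncation A l \<equiv> assemble A l l"

definition block_carrier :: "(nat \<Rightarrow> nat) \<Rightarrow> block_matrix set" where
  "block_carrier n = {A. \<forall>k l. A k l \<in> carrier_mat (n k) (n l)}"

definition block_one :: "(nat \<Rightarrow> nat) \<Rightarrow> block_matrix" where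
  "block_one n = (\<lambda>k l. if k = l then 1\<^sub>m (n k) else 0\<^sub>m (n k) (n l))"

definition block_transpose :: "block_matrix \<Rightarrow> block_matrix" where
  "block_transpose A = (\<lambda>k l. transpose_mat (A l k))"

text \<open>
  Below, the left factor is always block lower triangular, so that the series in the product
  has only finitely many nonzero terms.
\<close>

definition block_mult :: "(nat \<Rightarrow> nat) \<Rightarrow> block_matrix \<Rightarrow> block_matrix \<Rightarrow> block_matrix" where
  "block_mult n A B =
     (\<lambda>k l. mat (n k) (n l) (\<lambda>(a, b). \<Sum>j. (A k j * B j l) $$ (a, b)))"

definition block_lower_triangular :: "(nat \<Rightarrow> nat) \<Rightarrow> block_matrix \<Rightarrow> bool" where
  "block_lower_triangular n A \<longleftrightarrow>
     A \<in> block_carrier n \<and> (\<forall>k l. k < l \<longrightarrow> A k l = 0\<^sub>m (n k) (n l))"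

definition block_lower_unitriangular :: "(nat \<Rightarrow> nat) \<Rightarrow> block_matrix \<Rightarrow> bool" where
  "block_lower_unitriangular n A \<longleftrightarrow>
     block_lower_triangular n A \<and> (\<forall>k. A k k = 1\<^sub>m (n k))"

definition block_diagonal :: "(nat \<Rightarrow> nat) \<Rightarrow> block_matrix \<Rightarrow> bool" where
  "block_diagonal n A \<longleftrightarrow>
     A \<in> block_carrier n \<and> (\<forall>k l. k \<noteq> l \<longrightarrow> A k l = 0\<^sub>m (n k) (n l))"

text \<open>
  \<open>T\<close> is the inverse of the block lower triangular \<open>S\<close>; it is sought among block lower triangular
  matrices, since the associative law and uniqueness of inverses may fail for general
  semi-infinite matrices.
\<close>

definition block_inverse :: "(nat \<Rightarrow> nat) \<Rightarrow> block_matrix \<Rightarrow> block_matrix \<Rightarrow> bool" where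
  "block_inverse n S T \<longleftrightarrow> block_lower_triangular n T \<and>
     block_mult n S T = block_one n \<and> block_mult n T S = block_one n"

text \<open>\<open>G = S\<^sup>-\<^sup>1 H (S\<^sup>-\<^sup>1)\<^sup>T\<close>, with \<open>T\<close> standing for \<open>S\<^sup>-\<^sup>1\<close>.\<close>

definition block_cholesky ::
  "(nat \<Rightarrow> nat) \<Rightarrow> block_matrix \<Rightarrow> block_matrix \<Rightarrow> block_matrix \<Rightarrow> bool" where
  "block_cholesky n G S H \<longleftrightarrow>
     block_lower_unitriangular n S \<and> block_diagonal n H \<and>
     (\<exists>T. block_inverse n S T \<and>
          G = block_mult n (block_mult n T H) (block_transpose T))"

section \<open>Schur complements and last quasi-determinants\<close>

text \<open>
  The matrix partitioned as \<open>A B / C E\<close>. For invertible \<open>A\<close>, \<open>the (mat_inverse A)\<close> is the inverse.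
\<close>

definition schur_complement ::
  "real mat \<Rightarrow> real mat \<Rightarrow> real mat \<Rightarrow> real mat \<Rightarrow> real mat" where
  "schur_complement A B C E = E - C * the (mat_inverse A) * B"

text \<open>The last quasi-determinant of the block matrix with block indices \<open>0, \<dots>, n\<close>.\<close>

definition last_quasidet :: "nat \<Rightarrow> block_matrix \<Rightarrow> real mat" where
  "last_quasidet n M =
     schur_complement (assemble M n n) (assemble (\<lambda>i _. M i n) n 1) (block_row M n n) (M n n)"

section \<open>Moment matrix and orthogonal polynomials\<close>

definition moment_matrix :: "(real ^ 'd::{finite,linorder}) measure \<Rightarrow> block_matrix" where
  "moment_matrix \<mu> =
     (\<lambda>k l. mat (block_size TYPE('d) k) (block_size TYPE('d) l)
        (\<lambda>(i, j). \<integral>x. (chi k x * transpose_mat (chi l x)) $$ (i, j) \<partial>\<mu>))"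

text \<open>The block \<open>P\<^sub>k(x)\<close> of \<open>S \<chi>(x)\<close>, a column.\<close>

definition orth_poly :: "block_matrix \<Rightarrow> nat \<Rightarrow> real ^ 'd::{finite,linorder} \<Rightarrow> real mat" where
  "orth_poly S k x =
     mat (block_size TYPE('d) k) 1 (\<lambda>(i, j). \<Sum>l\<le>k. (S k l * chi l x) $$ (i, j))"

text \<open>Block columns \<open>0, \<dots>, l - 1\<close> come from the moment matrix, block column \<open>l\<close> is \<open>\<chi>(x)\<close>.\<close>

definition bordered_moment_matrix ::
  "(real ^ 'd::{finite,linorder}) measure \<Rightarrow> nat \<Rightarrow> real ^ 'd::{finite,linorder} \<Rightarrow> block_matrix" where
  "bordered_moment_matrix \<mu> l x = (\<lambda>i j. if j < l then moment_matrix \<mu> i j else chi i x)"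

end

theory Submission
  imports Defs
begin

text \<open>
  The factorization gives \<open>S G = H S\<^sup>-\<^sup>T\<close>, which is block upper triangular. The blocks of its
  block row \<open>l\<close> to the left of the diagonal therefore vanish: since \<open>S\<^sub>l\<^sub>l = 1\<close>, the row
  \<open>s = (S\<^sub>l\<^sub>0, \<dots>, S\<^sub>l\<^sub>,\<^sub>l\<^sub>-\<^sub>1)\<close> solves \<open>s G\<^sup>[\<^sup>l\<^sup>] + (G\<^sub>l\<^sub>0, \<dots>, G\<^sub>l\<^sub>,\<^sub>l\<^sub>-\<^sub>1) = 0\<close>. Solving for \<open>s\<close> and inserting
  it into \<open>P\<^sub>l = \<chi>\<^sub>l + s \<chi>\<^sup>[\<^sup>l\<^sup>]\<close> gives the Schur complement.
\<close>

section \<open>Products of semi-infinite block matrices\<close>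

lemma block_carrierD: "A \<in> block_carrier n \<Longrightarrow> A k l \<in> carrier_mat (n k) (n l)"
  by (simp add: block_carrier_def)

lemma block_lower_triangularD:
  assumes "block_lower_triangular n A"
  shows "A \<in> block_carrier n" "k < l \<Longrightarrow> A k l = 0\<^sub>m (n k) (n l)"
  using assms by (auto simp: block_lower_triangular_def)

lemma block_diagonal_imp_lower_triangular:
  "block_diagonal n A \<Longrightarrow> block_lower_triangular n A"
  by (simp add: block_diagonal_def block_lower_triangular_def)

lemma block_transpose_carrier: "A \<in> block_carrier n \<Longrightarrow> block_transpose A \<in> block_carrier n"
  by (simp add: block_carrier_def block_transpose_def)

lemma block_mult_carrier: "block_mult n A B \<in> block_carrier n"
  by (simp add: block_carrier_def block_mult_def)

text \<open>Terms with \<open>j > k\<close> vanish because \<open>A k j\<close> does. The cutoff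
  \<open>N\<close> may be any bound on \<open>k\<close>, so that sums from different block rows can
  share one range.\<close>

lemma block_mult_finite:
  assumes A: "block_lower_triangular n A" and B: "B \<in> block_carrier n"
    and k: "k \<le> N" and ab: "a < n k" "b < n l"
  shows "block_mult n A B k l $$ (a, b) = (\<Sum>j\<le>N. (A k j * B j l) $$ (a, b))"
proof -
  have "(\<Sum>j. (A k j * B j l) $$ (a, b)) = (\<Sum>j\<le>N. (A k j * B j l) $$ (a, b))"
  proof (rule suminf_finite)
    fix j assume "j \<notin> {..N}"
    then show "(A k j * B j l) $$ (a, b) = 0"
      using k ab block_lower_triangularD(2)[OF A, of k j] block_carrierD[OF B, of j l] by simp
  qed simp
  then show ?thesis
    using ab by (simp add: block_mult_def)
qed

lemma block_mult_index:
  assumes A: "block_lower_triangular n A" and B: "B \<in> block_carrier n"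
    and k: "k \<le> N" and ab: "a < n k" "b < n l"
  shows "block_mult n A B k l $$ (a, b) =
    (\<Sum>j\<le>N. \<Sum>c<n j. A k j $$ (a, c) * B j l $$ (c, b))"
proof -
  have "(A k j * B j l) $$ (a, b) = (\<Sum>c<n j. A k j $$ (a, c) * B j l $$ (c, b))" for j
    using ab block_carrierD[OF block_lower_triangularD(1)[OF A], of k j] block_carrierD[OF B, of j l]
    by (simp add: scalar_prod_def lessThan_atLeast0)
  then show ?thesis
    using block_mult_finite[OF assms] by simp
qed

text \<open>Above the diagonal only indices \<open>j \<le> k < l\<close> contribute, and there
  \<open>B j l\<close> is zero.\<close>

lemma block_mult_lower_triangular:
  assumes A: "block_lower_triangular n A" and B: "block_lower_triangular n B"
  shows "block_lower_triangular n (block_mult n A B)"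
  unfolding block_lower_triangular_def
proof (intro conjI allI impI)
  show "block_mult n A B \<in> block_carrier n" by (rule block_mult_carrier)
  fix k l :: nat assume kl: "k < l"
  show "block_mult n A B k l = 0\<^sub>m (n k) (n l)"
  proof (rule eq_matI)
    fix a b assume ab: "a < dim_row (0\<^sub>m (n k) (n l) :: real mat)"
      "b < dim_col (0\<^sub>m (n k) (n l) :: real mat)"
    then show "block_mult n A B k l $$ (a, b) = 0\<^sub>m (n k) (n l) $$ (a, b)"
      using kl block_lower_triangularD(2)[OF B, of _ l]
      by (simp add: block_mult_index[OF A block_lower_triangularD(1)[OF B] order_refl])
  qed (simp_all add: block_mult_def)
qed

text \<open>Triangularity of both left factors makes every sum finite, so the claim reduces to
  interchanging finite sums. No shape is required of \<open>C\<close>, which will be a transposed,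
  hence upper triangular, factor.\<close>

lemma block_mult_assoc:
  assumes A: "block_lower_triangular n A" and B: "block_lower_triangular n B"
    and C: "C \<in> block_carrier n"
  shows "block_mult n (block_mult n A B) C = block_mult n A (block_mult n B C)"
proof (intro ext eq_matI)
  fix k l a b
  assume "a < dim_row (block_mult n A (block_mult n B C) k l)"
    "b < dim_col (block_mult n A (block_mult n B C) k l)"
  then have ab: "a < n k" "b < n l" by (simp_all add: block_mult_def)
  note AB = block_mult_lower_triangular[OF A B] and B' = block_lower_triangularD(1)[OF B]
  let ?t = "\<lambda>i d j c. A k i $$ (a, d) * B i j $$ (d, c) * C j l $$ (c, b)"
  have "block_mult n (block_mult n A B) C k l $$ (a, b) =
      (\<Sum>j\<le>k. \<Sum>c<n j. \<Sum>i\<le>k. \<Sum>d<n i. ?t i d j c)"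
    using ab by (simp add: block_mult_index[OF AB C order_refl] block_mult_index[OF A B' order_refl]
        sum_distrib_right)
  also have "\<dots> = (\<Sum>j\<le>k. \<Sum>i\<le>k. \<Sum>c<n j. \<Sum>d<n i. ?t i d j c)"
    by (rule sum.cong[OF refl], rule sum.swap)
  also have "\<dots> = (\<Sum>i\<le>k. \<Sum>j\<le>k. \<Sum>c<n j. \<Sum>d<n i. ?t i d j c)"
    by (rule sum.swap)
  also have "\<dots> = (\<Sum>i\<le>k. \<Sum>j\<le>k. \<Sum>d<n i. \<Sum>c<n j. ?t i d j c)"
    by (rule sum.cong[OF refl], rule sum.cong[OF refl], rule sum.swap)
  also have "\<dots> = (\<Sum>i\<le>k. \<Sum>d<n i. \<Sum>j\<le>k. \<Sum>c<n j. ?t i d j c)"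
    by (rule sum.cong[OF refl], rule sum.swap)
  \<comment> \<open>Every block row \<open>i \<le> k\<close> of the inner product is evaluated with
    cutoff \<open>k\<close> instead of \<open>i\<close>, which makes the range of \<open>j\<close>
    independent of \<open>i\<close>.\<close>
  also have "\<dots> = block_mult n A (block_mult n B C) k l $$ (a, b)"
    using ab by (simp add: block_mult_index[OF A block_mult_carrier order_refl]
        block_mult_index[OF B C, of _ k] sum_distrib_left mult.assoc)
  finally show "block_mult n (block_mult n A B) C k l $$ (a, b) =
    block_mult n A (block_mult n B C) k l $$ (a, b)" .
qed (simp_all add: block_mult_def)

lemma block_one_mult:
  assumes A: "A \<in> block_carrier n"
  shows "block_mult n (block_one n) A = A"
proof (intro ext eq_matI)
  fix k l a b assume "a < dim_row (A k l)" "b < dim_col (A k l)"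
  then have ab: "a < n k" "b < n l" using block_carrierD[OF A, of k l] by auto
  have one: "block_lower_triangular n (block_one n)"
    by (simp add: block_lower_triangular_def block_carrier_def block_one_def)
  have "(block_one n k j * A j l) $$ (a, b) = (if j = k then A k l $$ (a, b) else 0)" for j
    using ab block_carrierD[OF A, of j l] by (auto simp: block_one_def)
  then show "block_mult n (block_one n) A k l $$ (a, b) = A k l $$ (a, b)"
    using ab by (simp add: block_mult_finite[OF one A order_refl])
qed (simp_all add: block_mult_def carrier_matD[OF block_carrierD[OF A]])

text \<open>The sum is an entry of \<open>S G = H T\<^sup>T\<close> strictly below the block
  diagonal. For the moment matrix it expresses that \<open>P\<^sub>l\<close> is orthogonal to the
  monomials of degree \<open>j\<close>.\<close>

lemma block_cholesky_row_orthogonal: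
  assumes chol: "block_cholesky n G S H" and jl: "j < l" and ab: "a < n l" "b < n j"
  shows "(\<Sum>i\<le>l. (S l i * G i j) $$ (a, b)) = 0"
proof -
  obtain T where T: "block_lower_triangular n T" "block_mult n S T = block_one n"
    and G: "G = block_mult n (block_mult n T H) (block_transpose T)"
    and S: "block_lower_triangular n S" and H: "block_diagonal n H"
    using chol by (auto simp: block_cholesky_def block_inverse_def block_lower_unitriangular_def)
  note H' = block_diagonal_imp_lower_triangular[OF H]
    and Tt = block_transpose_carrier[OF block_lower_triangularD(1)[OF T(1)]]
  have "block_mult n S G = block_mult n (block_mult n S (block_mult n T H)) (block_transpose T)"
    unfolding G
    by (rule block_mult_assoc[OF S block_mult_lower_triangular[OF T(1) H'] Tt, symmetric])
  \<comment> \<open>Regroup as \<open>(S T) H\<close> and cancel \<open>S T = 1\<close>.\<close>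
  also have "block_mult n S (block_mult n T H) = H"
    using T(2) by (simp add: block_mult_assoc[OF S T(1), symmetric] block_one_mult
        block_lower_triangularD(1)[OF H'])
  finally have SG: "block_mult n S G = block_mult n H (block_transpose T)" .
  \<comment> \<open>Off the diagonal \<open>H l i\<close> is zero; for \<open>i = l\<close> the
    other factor is the transpose of \<open>T j l\<close>, zero because
    \<open>j < l\<close>.\<close>
  have "H l i $$ (a, c) * block_transpose T i j $$ (c, b) = 0" if c: "c < n i" for i c
  proof (cases "i = l")
    case True
    then show ?thesis
      using jl ab c block_lower_triangularD(2)[OF T(1), of j l] by (simp add: block_transpose_def)
  next
    case False
    then show ?thesis using H ab c by (simp add: block_diagonal_def)
  qed
  then have "block_mult n H (block_transpose T) l j $$ (a, b) = 0"
    unfolding block_mult_index[OF H' Tt order_refl ab] by (intro sum.neutral ballI) simp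
  \<comment> \<open>The block sizes of \<open>G\<close> are known because the factorization presents
    it as a \<open>block_mult\<close>.\<close>
  then show ?thesis
    using SG block_mult_finite[OF S _ order_refl ab, of G] G block_mult_carrier by simp
qed

section \<open>Finite block rows and assembled matrices\<close>

lemma block_row_carrier:
  assumes "\<And>j. A k j \<in> carrier_mat r (p j)"
  shows "block_row A k N \<in> carrier_mat r (\<Sum>j<N. p j)"
proof (induction N)
  case 0
  show ?case using assms[of 0] by simp
next
  case (Suc N)
  show ?case
    using four_block_carrier_mat[OF Suc, of "0\<^sub>m 0 (p N)" 0 "p N"]
      carrier_matD[OF Suc] carrier_matD[OF assms[of N]] by simp
qed

lemma assemble_carrier:
  assumes "\<And>i j. A i j \<in> carrier_mat (n i) (p j)"
  shows "assemble A m N \<in> carrier_mat (\<Sum>i<m. n i) (\<Sum>j<N. p j)"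
proof (induction m)
  case 0
  show ?case using block_row_carrier[of A 0 "n 0" p N] assms by simp
next
  case (Suc m)
  show ?case
    using carrier_append_rows[OF Suc block_row_carrier[of A m "n m" p N]] assms by simp
qed

text \<open>An empty block row still takes its height from \<open>A k 0\<close>, a block outside the
  range of agreement; hence \<open>0 < N\<close>.\<close>

lemma block_row_cong:
  assumes "0 < N" and "\<And>j. j < N \<Longrightarrow> A k j = B k j"
  shows "block_row A k N = block_row B k N"
  using assms by (induction N rule: nat_induct_non_zero) simp_all

text \<open>Agreement is asked in all block rows, not only below \<open>m\<close>, since for
  \<open>m = 0\<close> the width is read off block row 0.\<close>

lemma assemble_cong:
  assumes "0 < N" and "\<And>i j. j < N \<Longrightarrow> A i j = B i j"
  shows "assemble A m N = assemble B m N"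
  by (induction m) (use assms block_row_cong[of N A _ B] in simp_all)

lemma block_row_1: "block_row A k 1 = A k 0"
  by (rule eq_matI) auto

lemma block_row_zero:
  assumes "\<And>j. j < N \<Longrightarrow> A k j = 0\<^sub>m r (p j)" and "dim_row (A k 0) = r"
  shows "block_row A k N = 0\<^sub>m r (\<Sum>j<N. p j)"
  using assms(1)
proof (induction N)
  case 0
  show ?case using assms(2) by simp
next
  case (Suc N)
  then have "block_row A k N = 0\<^sub>m r (\<Sum>j<N. p j)" "A k N = 0\<^sub>m r (p N)" by simp_all
  then show ?case by (intro eq_matI) auto
qed

lemma block_row_add:
  assumes "\<And>j. A k j \<in> carrier_mat r (p j)" and "\<And>j. B k j \<in> carrier_mat r (p j)"
  shows "block_row A k N + block_row B k N = block_row (\<lambda>k j. A k j + B k j) k N"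
proof (induction N)
  case 0
  show ?case using assms(1)[of 0] assms(2)[of 0] by simp
next
  case (Suc N)
  note dims = carrier_matD[OF assms(1)] carrier_matD[OF assms(2)]
    carrier_matD[OF block_row_carrier[of A k r p N, OF assms(1)]]
    carrier_matD[OF block_row_carrier[of B k r p N, OF assms(2)]]
  show ?case
    by (intro eq_matI) (auto simp: Suc[symmetric] dims)
qed

lemma mult_block_row:
  assumes A: "A \<in> carrier_mat r s" and B: "\<And>j. B i j \<in> carrier_mat s (p j)"
    and C: "\<And>j. C k j = A * B i j"
  shows "A * block_row B i N = block_row C k N"
proof (induction N)
  case 0
  show ?case using A B[of 0] C[of 0] by (intro eq_matI) auto
next
  case (Suc N)
  note R = block_row_carrier[of B i s p N, OF B]
  have "A * block_row B i (Suc N) =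
      four_block_mat (A * block_row B i N) (A * B i N)
        (0\<^sub>m 0 (dim_col (block_row B i N))) (0\<^sub>m 0 (dim_col (B i N)))"
    using A R B[of N] by (intro eq_matI) (auto simp: scalar_prod_def)
  then show ?case using R B[of N] A by (simp add: Suc[symmetric] C)
qed

text \<open>Both factors are 2 by 2 block matrices with degenerate blocks, of zero rows on the left
  and zero columns on the right. In the general block product only the upper left block then has
  entries.\<close>

lemma row_mult_append_rows:
  fixes R A B Q :: "real mat"
  assumes "R \<in> carrier_mat r s" "A \<in> carrier_mat r t" "B \<in> carrier_mat s u" "Q \<in> carrier_mat t u"
  shows "four_block_mat R A (0\<^sub>m 0 s) (0\<^sub>m 0 t) * (B @\<^sub>r Q) = R * B + A * Q"
proof -
  have "four_block_mat R A (0\<^sub>m 0 s) (0\<^sub>m 0 t) * (B @\<^sub>r Q) =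
      four_block_mat (R * B + A * Q) (R * 0\<^sub>m s 0 + A * 0\<^sub>m t 0)
        (0\<^sub>m 0 s * B + 0\<^sub>m 0 t * Q) (0\<^sub>m 0 s * 0\<^sub>m s 0 + 0\<^sub>m 0 t * 0\<^sub>m t 0)"
    unfolding append_rows_def using assms by (subst mult_four_block_mat) auto
  also have "\<dots> = R * B + A * Q"
    using assms by (intro eq_matI) auto
  finally show ?thesis .
qed

text \<open>Induction on \<open>m\<close> splits off the last block of the left row together with
  the last block row of the right factor. Writing the block sums entrywise fixes their size even
  when \<open>m = 0\<close>.\<close>

lemma block_row_mult_assemble:
  assumes A: "\<And>j. A k j \<in> carrier_mat r (n j)"
    and B: "\<And>i j. B i j \<in> carrier_mat (n i) (p j)"
  shows "block_row A k m * assemble B m N =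
    block_row (\<lambda>k j. mat r (p j) (\<lambda>(a, b). \<Sum>i<m. (A k i * B i j) $$ (a, b))) k N"
proof (induction m)
  case 0
  have "block_row A k 0 * assemble B 0 N = 0\<^sub>m r (\<Sum>j<N. p j)"
    using A[of 0] block_row_carrier[of B 0 "n 0" p N] B by (intro eq_matI) (auto simp: scalar_prod_def)
  also have "\<dots> = block_row (\<lambda>k j. mat r (p j) (\<lambda>(a, b). \<Sum>i<0. (A k i * B i j) $$ (a, b))) k N"
    by (rule block_row_zero[symmetric]) (auto intro!: eq_matI)
  finally show ?case .
next
  case (Suc m)
  let ?C = "\<lambda>m k j. mat r (p j) (\<lambda>(a, b). \<Sum>i<m. (A k i * B i j) $$ (a, b))"
  note R = block_row_carrier[of A k r n m, OF A]
  have "block_row A k (Suc m) * assemble B (Suc m) N =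
      block_row A k m * assemble B m N + A k m * block_row B m N"
    using R A[of m] row_mult_append_rows[OF R A[of m] assemble_carrier[of B n p m N, OF B]
        block_row_carrier[of B m "n m" p N, OF B]] by simp
  also have "\<dots> = block_row (?C m) k N + block_row (\<lambda>_ j. A k m * B m j) k N"
    unfolding Suc by (subst mult_block_row[where C = "\<lambda>_ j. A k m * B m j", OF A B]) simp_all
  also have "\<dots> = block_row (\<lambda>k' j. ?C m k' j + A k m * B m j) k N"
    by (rule block_row_add[where r = r and p = p]) (auto intro: mult_carrier_mat[OF A B])
  also have "\<dots> = block_row (?C (Suc m)) k N"
  \<comment> \<open>Congruence of block rows covers only nonempty rows; for \<open>N = 0\<close>
    just the heights are compared.\<close>
  proof (cases "N = 0")
    case True
    then show ?thesis using A[of m] by simp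
  next
    case False
    then show ?thesis
      using carrier_matD[OF A] carrier_matD[OF B] by (intro block_row_cong eq_matI) simp_all
  qed
  finally show ?case .
qed

section \<open>Schur complements\<close>

text \<open>The equation for \<open>X\<close> forces \<open>X = - C A\<^sup>-\<^sup>1\<close>, so
  any solution can stand in for the inverse in the Schur complement.\<close>

lemma schur_complement_eq_add_mult:
  assumes A: "A \<in> carrier_mat m m" and B: "B \<in> carrier_mat m c"
    and C: "C \<in> carrier_mat r m" and E: "E \<in> carrier_mat r c" and X: "X \<in> carrier_mat r m"
    and det: "Determinant.det A \<noteq> 0" and XA: "X * A + C = 0\<^sub>m r m"
  shows "schur_complement A B C E = E + X * B"
proof -
  \<comment> \<open>A nonzero determinant makes \<open>A\<close> a unit of the matrix ring, which
    rules out \<open>None\<close>; \<open>the\<close> therefore yields the true inverse.\<close>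
  obtain I where I: "mat_inverse A = Some I"
    using det_non_zero_imp_unit[OF A det, of "()"] mat_inverse(1)[OF A, of "()"]
    by (cases "mat_inverse A") auto
  have inv: "A * I = 1\<^sub>m m" "I \<in> carrier_mat m m"
    using mat_inverse(2)[OF A I] by auto
  have "C = - (X * A)"
  proof (rule eq_matI)
    fix i j assume ij: "i < dim_row (- (X * A))" "j < dim_col (- (X * A))"
    have "(X * A + C) $$ (i, j) = 0" using ij XA X A by auto
    then show "C $$ (i, j) = (- (X * A)) $$ (i, j)" using ij X A C by simp
  qed (use X A C in auto)
  then have "C * I = - (X * (A * I))"
    using X A inv by (simp add: assoc_mult_mat[of X r m A m I m])
  then have "C * I = - X" using inv X by simp
  then show ?thesis
    using I E X B by (simp add: schur_complement_def) (intro eq_matI; auto)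
qed

section \<open>Orthogonal polynomials\<close>

lemma chi_carrier:
  "chi k (x :: real ^ 'd::{finite,linorder}) \<in> carrier_mat (block_size TYPE('d) k) 1"
  by (simp add: chi_def)

lemma moment_matrix_carrier:
  "moment_matrix (\<mu> :: (real ^ 'd::{finite,linorder}) measure) \<in> block_carrier (block_size TYPE('d))"
  by (simp add: moment_matrix_def block_carrier_def)

text \<open>The term \<open>i = l\<close> is split off the defining sum; it equals
  \<open>chi l x\<close> because the diagonal block of \<open>S\<close> is the identity.\<close>

lemma orth_poly_eq_add_mult:
  fixes x :: "real ^ 'd::{finite,linorder}"
  assumes S: "block_lower_unitriangular (block_size TYPE('d)) S"
  shows "orth_poly S l x = chi l x + block_row S l l * assemble (\<lambda>i _. chi i x) l 1"
proof -
  let ?n = "block_size TYPE('d)"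
  have Sc: "S l j \<in> carrier_mat (?n l) (?n j)" for j
    using S by (simp add: block_lower_unitriangular_def block_lower_triangular_def block_carrier_def)
  have "block_row S l l * assemble (\<lambda>i _. chi i x) l 1 =
      mat (?n l) 1 (\<lambda>(a, b). \<Sum>i<l. (S l i * chi i x) $$ (a, b))"
    using block_row_mult_assemble[of S l "?n l" ?n "\<lambda>i _. chi i x" "\<lambda>_. 1" l 1] Sc chi_carrier[of _ x]
    by (simp only: block_row_1)
  moreover have "S l l * chi l x = chi l x"
    using S left_mult_one_mat[OF chi_carrier[of l x]] by (simp add: block_lower_unitriangular_def)
  ultimately show ?thesis
    using chi_carrier[of l x]
    by (intro eq_matI) (auto simp: orth_poly_def lessThan_Suc_atMost[symmetric])
qed

lemma block_cholesky_row_equation: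
  assumes G: "G \<in> block_carrier n" and chol: "block_cholesky n G S H"
  shows "block_row S l l * truncation G l + block_row G l l = 0\<^sub>m (n l) (\<Sum>j<l. n j)"
proof -
  have S: "S l j \<in> carrier_mat (n l) (n j)" and Sll: "S l l = 1\<^sub>m (n l)" for j
    using chol by (auto simp: block_cholesky_def block_lower_unitriangular_def
        block_lower_triangular_def block_carrier_def)
  let ?C = "\<lambda>k j. mat (n l) (n j) (\<lambda>(a, b). \<Sum>i<l. (S k i * G i j) $$ (a, b))"
  have "block_row S l l * truncation G l + block_row G l l = block_row ?C l l + block_row G l l"
    using block_row_mult_assemble[of S l "n l" n G n l l] S block_carrierD[OF G] by simp
  also have "\<dots> = block_row (\<lambda>k j. ?C k j + G k j) l l"
    by (rule block_row_add[where r = "n l" and p = n]) (use block_carrierD[OF G] in auto)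
  also have "\<dots> = 0\<^sub>m (n l) (\<Sum>j<l. n j)"
  proof (rule block_row_zero)
    fix j assume j: "j < l"
    show "?C l j + G l j = 0\<^sub>m (n l) (n j)"
    proof (rule eq_matI)
      fix a b assume "a < dim_row (0\<^sub>m (n l) (n j) :: real mat)"
        "b < dim_col (0\<^sub>m (n l) (n j) :: real mat)"
      then have ab: "a < n l" "b < n j" by simp_all
      \<comment> \<open>The orthogonality sum runs up to \<open>l\<close>, the assembled product
        only up to \<open>l - 1\<close>. The missing last term is exactly the added block
        \<open>G l j\<close>.\<close>
      have "S l l * G l j = G l j"
        using Sll left_mult_one_mat[OF block_carrierD[OF G]] by simp
      then show "(?C l j + G l j) $$ (a, b) = 0\<^sub>m (n l) (n j) $$ (a, b)"
        using block_cholesky_row_orthogonal[OF chol j ab] ab block_carrierD[OF G, of l j]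
        by (simp add: lessThan_Suc_atMost[symmetric])
    qed (use block_carrierD[OF G, of l j] in auto)
  qed (use block_carrierD[OF G, of l 0] in auto)
  finally show ?thesis .
qed

lemma last_quasidet_bordered_moment_matrix:
  assumes "l \<ge> 1"
  shows "last_quasidet l (bordered_moment_matrix \<mu> l x) =
    schur_complement (truncation (moment_matrix \<mu>) l) (assemble (\<lambda>i _. chi i x) l 1)
      (block_row (moment_matrix \<mu>) l l) (chi l x)"
proof -
  have "truncation (bordered_moment_matrix \<mu> l x) l = truncation (moment_matrix \<mu>) l"
    using assms by (intro assemble_cong) (auto simp: bordered_moment_matrix_def)
  moreover have "block_row (bordered_moment_matrix \<mu> l x) l l = block_row (moment_matrix \<mu>) l l"
    using assms by (intro block_row_cong) (auto simp: bordered_moment_matrix_def)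
  ultimately show ?thesis
    \<comment> \<open>The equations above concern the folded bordered matrix, so they are applied
      first; unfolding then treats the border column and the corner.\<close>
    by (simp add: last_quasidet_def) (simp add: bordered_moment_matrix_def)
qed

theorem proposition2p4p3:
  fixes \<Omega> :: "(real ^ 'd::{finite,linorder}) set"
    and \<mu> :: "(real ^ 'd::{finite,linorder}) measure"
    and S H :: block_matrix
    and l :: nat
    and x :: "real ^ 'd::{finite,linorder}"
  assumes borel: "sets \<mu> = sets (restrict_space borel \<Omega>)"
    and finite_moments: "\<And>\<alpha>. integrable \<mu> (monomial \<alpha>)"
    and nondegenerate: "\<And>k. Determinant.det (truncation (moment_matrix \<mu>) k) \<noteq> 0"
    and cholesky: "block_cholesky (block_size TYPE('d)) (moment_matrix \<mu>) S H"
    and l: "l \<ge> 1"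
  shows "orth_poly S l x =
      schur_complement
        (truncation (moment_matrix \<mu>) l)  (assemble (\<lambda>i _. chi i x) l 1)
        (block_row (moment_matrix \<mu>) l l) (chi l x)
    \<and> orth_poly S l x = last_quasidet l (bordered_moment_matrix \<mu> l x)"
proof -
  let ?n = "block_size TYPE('d)"
  let ?m = "\<Sum>j<l. ?n j"
  have S: "block_lower_unitriangular ?n S"
    using cholesky by (simp add: block_cholesky_def)
  have "orth_poly S l x = chi l x + block_row S l l * assemble (\<lambda>i _. chi i x) l 1"
    by (rule orth_poly_eq_add_mult[OF S])
  also have "\<dots> = schur_complement (truncation (moment_matrix \<mu>) l)
      (assemble (\<lambda>i _. chi i x) l 1) (block_row (moment_matrix \<mu>) l l) (chi l x)"
  \<comment> \<open>The solution \<open>X\<close> is the part of block row \<open>l\<close> of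
    \<open>S\<close> left of the diagonal.\<close>
  proof (rule schur_complement_eq_add_mult[symmetric])
    note G = block_carrierD[OF moment_matrix_carrier[of \<mu>]]
    show "truncation (moment_matrix \<mu>) l \<in> carrier_mat ?m ?m"
      by (rule assemble_carrier[OF G])
    show "assemble (\<lambda>i _. chi i x) l 1 \<in> carrier_mat ?m 1"
      using assemble_carrier[of "\<lambda>i _. chi i x" ?n "\<lambda>_. 1" l 1] chi_carrier[of _ x] by simp
    show "block_row (moment_matrix \<mu>) l l \<in> carrier_mat (?n l) ?m"
      by (rule block_row_carrier[OF G])
    show "chi l x \<in> carrier_mat (?n l) 1"
      by (rule chi_carrier)
    show "block_row S l l \<in> carrier_mat (?n l) ?m"
      using S by (intro block_row_carrier)
        (simp add: block_lower_unitriangular_def block_lower_triangular_def block_carrier_def)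
    show "Determinant.det (truncation (moment_matrix \<mu>) l) \<noteq> 0"
      by (rule nondegenerate)
    show "block_row S l l * truncation (moment_matrix \<mu>) l + block_row (moment_matrix \<mu>) l l =
        0\<^sub>m (?n l) ?m"
      by (rule block_cholesky_row_equation[OF moment_matrix_carrier cholesky])
  qed
  finally show ?thesis
    using last_quasidet_bordered_moment_matrix[OF l, of \<mu> x] by simp
qed

end
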